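(* Let $p$ be a prime, $n\in\mathbb{Z}^+$, and let $i,d\in[0,n]$ with $\ell=\ell_p(d)=\lceil\log_p(d+1)\rceil$. Then, over $\mathbb{F}_p$, \[ \operatorname{Z\text{-}cl}_{n,d}(i)=\begin{cases}\{i\},& i\notin[d,n-d],\\ i\oplus p^\ell,& i\in[d,n-d],\end{cases} \] where $i\oplus p^\ell=\{t\in[0,n]: t\equiv i \pmod{p^\ell}\}$.
   Context: For integers $a\le b$, $[a,b]$ denotes the set of integers between $a$ and $b$. Work over the field $\mathbb{F}_p$ and view $\{0,1\}^n\subseteq\mathbb{F}_p^n$. For $x\in\{0,1\}^n$, $|x|$ is its Hamming weight (number of coordinates equal to $1$). For $E\subseteq[0,n]$ let $\underline{E}=\{x\in\{0,1\}^n:|x|\in E\}$. For $S\subseteq\{0,1\}^n$ and $d\in[0,n]$, the degree-$d$ Zariski closure $\operatorname{Z\text{-}cl}_{n,d}(S)$ is the set of all $y\in\{0,1\}^n$ such that every polynomial $f\in\mathbb{F}_p[X_1,\dots,X_n]$ with $\deg f\le d$ vanishing on all of $S$ also vanishes at $y$. For $S=\underline{E}$ this set is symmetric, and is identified with the set $\{|y|: y\in\operatorname{Z\text{-}cl}_{n,d}(\underline{E})\}\subseteq[0,n]$; this subset is denoted $\operatorname{Z\text{-}cl}_{n,d}(E)$, and $\operatorname{Z\text{-}cl}_{n,d}(i)$ means $\operatorname{Z\text{-}cl}_{n,d}(\{i\})$. *)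

theory Defs
  imports
    Complex_Main
    "HOL-Library.Poly_Mapping"
    "HOL-Library.FuncSet"
    "HOL-Number_Theory.Cong"
    "Berlekamp_Zassenhaus.Finite_Field"
begin

text \<open>A multivariate polynomial is a finitely supported map from monomials to coefficients; a
  monomial is a finitely supported map from variable indices to exponents.  The variables are
  indexed by all of \<^typ>\<open>nat\<close>, and the ring in the variables \<open>X\<^sub>1, \<dots>, X\<^sub>n\<close> is carved out by
  \<open>polys_in\<close>.\<close>

type_synonym monomial = "nat \<Rightarrow>\<^sub>0 nat"
type_synonym 'a mpoly = "monomial \<Rightarrow>\<^sub>0 'a"

definition polys_in :: "nat \<Rightarrow> 'a::zero mpoly set" where
  "polys_in n = {f. \<forall>m \<in> Poly_Mapping.keys f. Poly_Mapping.keys m \<subseteq> {1..n}}"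

definition monomial_degree :: "monomial \<Rightarrow> nat" where
  "monomial_degree m = (\<Sum>j \<in> Poly_Mapping.keys m. Poly_Mapping.lookup m j)"

text \<open>The zero polynomial gets degree 0, so it satisfies every bound \<open>\<le> d\<close>, as it does under the
  convention that its degree is \<open>-\<infinity>\<close>.\<close>

definition total_degree :: "'a::zero mpoly \<Rightarrow> nat" where
  "total_degree f = Max (insert 0 (monomial_degree ` Poly_Mapping.keys f))"

definition eval_mpoly :: "'a::comm_semiring_1 mpoly \<Rightarrow> (nat \<Rightarrow> 'a) \<Rightarrow> 'a" where
  "eval_mpoly f x = (\<Sum>m \<in> Poly_Mapping.keys f.
     Poly_Mapping.lookup f m * (\<Prod>j \<in> Poly_Mapping.keys m. x j ^ Poly_Mapping.lookup m j))"

definition cube :: "nat \<Rightarrow> (nat \<Rightarrow> 'a::zero_neq_one) set" where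
  "cube n = {1..n} \<rightarrow>\<^sub>E {0, 1}"

definition hamming_weight :: "nat \<Rightarrow> (nat \<Rightarrow> 'a::zero_neq_one) \<Rightarrow> nat" where
  "hamming_weight n x = card {j \<in> {1..n}. x j = 1}"

definition weight_layers :: "nat \<Rightarrow> nat set \<Rightarrow> (nat \<Rightarrow> 'a::zero_neq_one) set" where
  "weight_layers n E = {x \<in> cube n. hamming_weight n x \<in> E}"

definition Zcl :: "nat \<Rightarrow> nat \<Rightarrow> (nat \<Rightarrow> 'a::field) set \<Rightarrow> (nat \<Rightarrow> 'a) set" where
  "Zcl n d S = {y \<in> cube n. \<forall>f \<in> polys_in n.
     total_degree f \<le> d \<longrightarrow> (\<forall>x \<in> S. eval_mpoly f x = 0) \<longrightarrow> eval_mpoly f y = 0}"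

text \<open>The type argument selects the ground field, which cannot be inferred from sets of weights.\<close>

definition Zcl_weights :: "'a::field itself \<Rightarrow> nat \<Rightarrow> nat \<Rightarrow> nat set \<Rightarrow> nat set" where
  "Zcl_weights F n d E = hamming_weight n ` Zcl n d (weight_layers n E :: (nat \<Rightarrow> 'a) set)"

definition digit_length :: "nat \<Rightarrow> nat \<Rightarrow> nat" where
  "digit_length p d = nat \<lceil>log (real p) (real (d + 1))\<rceil>"

definition residue_layers :: "nat \<Rightarrow> nat \<Rightarrow> nat \<Rightarrow> nat set" where
  "residue_layers n i m = {t \<in> {0..n}. [t = i] (mod m)}"

end

theory Submission
  imports Defs
begin

text \<open>On the cube, polynomials of degree at most \<open>d\<close> are combinations of the functions
  \<open>U \<mapsto> [S \<subseteq> U]\<close> with \<open>card S \<le> d\<close>, and this space is stable under complementing \<open>U\<close>.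
  If \<open>i < d\<close> (or \<open>n - i < d\<close>, by complementation), then a monomial of degree \<open>i + 1\<close> separates
  layer \<open>i\<close> from the points above it, and \<open>[T \<subseteq> U]\<close> minus the sum of all \<open>[R \<subseteq> U]\<close>
  with \<open>T \<subseteq> R\<close>, \<open>card R = i\<close> separates it from a point \<open>T\<close> below it.
  For \<open>k < l\<close> the elementary symmetric polynomial of degree \<open>p ^ k \<le> d\<close> takes the value
  \<open>card U choose p ^ k\<close>, which modulo \<open>p\<close> is the \<open>k\<close>-th base-\<open>p\<close> digit of \<open>card U\<close>, so
  incongruent layers are separated. If \<open>T\<close> lies in a congruent layer above
  layer \<open>i \<ge> d\<close>, the value at \<open>T\<close> is a sum of values on layer \<open>i\<close>, because
  \<open>(a + q * p ^ l) choose a\<close> is \<open>1\<close> modulo \<open>p\<close> for \<open>a \<le> d < p ^ l\<close>; layers below follow by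
  complementation.\<close>

section \<open>Binomial coefficients modulo a prime\<close>

text \<open>Absorption gives
  \<open>j * (p ^ k choose j) = p ^ k * ((p ^ k - 1) choose (j - 1))\<close>. If \<open>p\<close>
  did not divide the binomial coefficient, \<open>p ^ k\<close> would have to divide
  \<open>j\<close>, which is too small.\<close>

lemma prime_dvd_prime_power_choose:
  fixes p :: nat
  assumes "prime p" "0 < j" "j < p ^ k"
  shows "p dvd (p ^ k choose j)"
proof (rule ccontr)
  assume "\<not> p dvd (p ^ k choose j)"
  then have "coprime (p ^ k) (p ^ k choose j)"
    using assms(1) by (simp add: prime_imp_coprime)
  moreover have "j * (p ^ k choose j) = p ^ k * ((p ^ k - 1) choose (j - 1))"
    using assms by (metis binomial_absorption Suc_diff_1)
  ultimately have "p ^ k dvd j"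
    by (metis coprime_dvd_mult_left_iff dvd_triv_left)
  with assms show False by (auto dest: dvd_imp_le)
qed

text \<open>Vandermonde's identity, where only the two extreme terms survive modulo
  \<open>p\<close>; this is \<open>(1 + X) ^ (p ^ k) = 1 + X ^ (p ^ k)\<close> read
  coefficientwise.\<close>

lemma binomial_add_prime_power_cong:
  fixes p :: nat
  assumes "prime p"
  shows "[(m + p ^ k) choose j = (m choose j) + (if p ^ k \<le> j then m choose (j - p ^ k) else 0)] (mod p)"
proof -
  let ?f = "\<lambda>r. (p ^ k choose r) * (m choose (j - r))"
  \<comment> \<open>Two separate conditionals, so that each sum over \<open>r \<le> j\<close>
    collapses on its own; the second one contributes only if \<open>p ^ k \<le> j\<close>.\<close>
  let ?g = "\<lambda>r. (if r = 0 then m choose j else 0) + (if r = p ^ k then m choose (j - r) else 0)"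
  have pos: "0 < p ^ k" using assms by (simp add: prime_gt_0_nat)
  have "[?f r = ?g r] (mod p)" for r
  proof -
    consider "r = 0" | "r = p ^ k" | "0 < r" "r < p ^ k" | "r > p ^ k" by linarith
    then show ?thesis
    proof cases
      case 3
      then have "p dvd ?f r" using prime_dvd_prime_power_choose[OF assms] by simp
      with 3 show ?thesis by (simp add: cong_0_iff)
    qed (use pos in \<open>auto simp: binomial_eq_0\<close>)
  qed
  then have "[(\<Sum>r\<le>j. ?f r) = (\<Sum>r\<le>j. ?g r)] (mod p)"
    by (intro cong_sum)
  then show ?thesis
    by (simp only: vandermonde sum.distrib sum.delta sum.delta' finite_atMost add.commute[of m])
      simp
qed

lemma binomial_add_multiple_prime_power_cong:
  fixes p :: nat
  assumes "prime p" "j < p ^ k"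
  shows "[(m + q * p ^ k) choose j = m choose j] (mod p)"
proof (induction q)
  case (Suc q)
  have "[((m + q * p ^ k) + p ^ k) choose j = (m + q * p ^ k) choose j] (mod p)"
    using binomial_add_prime_power_cong[OF assms(1), of "m + q * p ^ k" k j] assms(2) by simp
  with Suc show ?case by (auto simp: algebra_simps intro: cong_trans)
qed simp

text \<open>A special case of Lucas' theorem: starting from \<open>r < p ^ k\<close>, where the
  binomial coefficient is 0, each added \<open>p ^ k\<close> raises it by 1 modulo
  \<open>p\<close>.\<close>

lemma choose_prime_power_cong_digit:
  fixes p :: nat
  assumes "prime p"
  shows "[t choose (p ^ k) = t div p ^ k] (mod p)"
proof -
  have pos: "0 < p ^ k" using assms by (simp add: prime_gt_0_nat)
  have "[(r + q * p ^ k) choose (p ^ k) = q] (mod p)" if "r < p ^ k" for q r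
  proof (induction q)
    case (Suc q)
    have "[((r + q * p ^ k) + p ^ k) choose (p ^ k) = ((r + q * p ^ k) choose (p ^ k)) + 1] (mod p)"
      using binomial_add_prime_power_cong[OF assms, of "r + q * p ^ k" k "p ^ k"] by simp
    moreover have "[((r + q * p ^ k) choose (p ^ k)) + 1 = q + 1] (mod p)"
      using Suc by (intro cong_add) auto
    ultimately show ?case by (auto simp: algebra_simps intro: cong_trans)
  qed (use that in \<open>simp add: binomial_eq_0\<close>)
  from this[of "t mod p ^ k" "t div p ^ k"] pos show ?thesis by (simp only: mod_div_mult_eq mod_less_divisor)
qed

text \<open>The binomial coefficients determine the base-\<open>p\<close> digits below position
  \<open>l\<close>, and the induction recovers the residue one digit at a time.\<close>

lemma cong_prime_power_if_binomials_cong: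
  fixes p :: nat
  assumes "prime p" "\<And>k. k < l \<Longrightarrow> [t choose (p ^ k) = i choose (p ^ k)] (mod p)"
  shows "[t = i] (mod p ^ l)"
  using assms(2)
proof (induction l)
  case (Suc l)
  have "[t = i] (mod p ^ l)" using Suc by simp
  moreover have "[t div p ^ l = i div p ^ l] (mod p)"
    using Suc.prems[of l] choose_prime_power_cong_digit[OF assms(1)]
    by (meson cong_sym cong_trans lessI)
  ultimately show ?case
    by (simp add: cong_def mod_mult2_eq mult.commute[of p])
qed simp

section \<open>Low-degree functions on subsets\<close>

text \<open>A point of the cube is identified with its support, and a multilinear monomial with the
  set of its variables.\<close>

definition lowdeg :: "'v set \<Rightarrow> nat \<Rightarrow> ('v set \<Rightarrow> 'a::comm_ring_1) set" where
  "lowdeg V d = range (\<lambda>c U. \<Sum>S | S \<subseteq> V \<and> card S \<le> d. c S * of_bool (S \<subseteq> U))"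

lemma lowdegE:
  assumes "g \<in> lowdeg V d"
  obtains c where "\<And>U. g U = (\<Sum>S | S \<subseteq> V \<and> card S \<le> d. c S * of_bool (S \<subseteq> U))"
  using assms by (auto simp: lowdeg_def)

lemma lowdeg_zero: "(\<lambda>U. 0) \<in> lowdeg V d"
  unfolding lowdeg_def by (rule range_eqI[of _ _ "\<lambda>_. 0"]) simp

lemma lowdeg_add:
  assumes "g \<in> lowdeg V d" "h \<in> lowdeg V d"
  shows "(\<lambda>U. g U + h U) \<in> lowdeg V d"
proof -
  obtain b where b: "\<And>U. g U = (\<Sum>S | S \<subseteq> V \<and> card S \<le> d. b S * of_bool (S \<subseteq> U))"
    using assms(1) by (rule lowdegE) (rule that)
  obtain c where c: "\<And>U. h U = (\<Sum>S | S \<subseteq> V \<and> card S \<le> d. c S * of_bool (S \<subseteq> U))"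
    using assms(2) by (rule lowdegE) (rule that)
  from b c show ?thesis
    unfolding lowdeg_def
    by (intro range_eqI[of _ _ "\<lambda>S. b S + c S"]) (simp add: sum.distrib algebra_simps fun_eq_iff)
qed

lemma lowdeg_scale:
  assumes "g \<in> lowdeg V d"
  shows "(\<lambda>U. a * g U) \<in> lowdeg V d"
proof -
  obtain c where "\<And>U. g U = (\<Sum>S | S \<subseteq> V \<and> card S \<le> d. c S * of_bool (S \<subseteq> U))"
    using assms by (rule lowdegE) (rule that)
  then show ?thesis
    unfolding lowdeg_def
    by (intro range_eqI[of _ _ "\<lambda>S. a * c S"]) (simp add: sum_distrib_left mult.assoc fun_eq_iff)
qed

lemma lowdeg_diff:
  assumes "g \<in> lowdeg V d" "h \<in> lowdeg V d"
  shows "(\<lambda>U. g U - h U) \<in> lowdeg V d"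
  using lowdeg_add[OF assms(1) lowdeg_scale[OF assms(2), of "-1"]] by simp

lemma lowdeg_sum:
  assumes "\<And>x. x \<in> A \<Longrightarrow> g x \<in> lowdeg V d"
  shows "(\<lambda>U. \<Sum>x\<in>A. g x U) \<in> lowdeg V d"
  using assms
  by (induction A rule: infinite_finite_induct) (auto simp: lowdeg_zero intro: lowdeg_add)

lemma lowdeg_monomial:
  assumes "finite V" "S \<subseteq> V" "card S \<le> d"
  shows "(\<lambda>U. of_bool (S \<subseteq> U) :: 'a::comm_ring_1) \<in> lowdeg V d"
proof -
  have "(\<Sum>R | R \<subseteq> V \<and> card R \<le> d. of_bool (R = S) * of_bool (R \<subseteq> U)) = (of_bool (S \<subseteq> U) :: 'a)" for U
  proof -
    have "(\<Sum>R | R \<subseteq> V \<and> card R \<le> d. of_bool (R = S) * of_bool (R \<subseteq> U))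
        = (\<Sum>R | R \<subseteq> V \<and> card R \<le> d. if R = S then of_bool (S \<subseteq> U) else 0 :: 'a)"
      by (intro sum.cong) auto
    with assms show ?thesis by simp
  qed
  then show ?thesis
    unfolding lowdeg_def by (intro range_eqI[of _ _ "\<lambda>R. of_bool (R = S)"]) simp
qed

lemma lowdeg_const:
  assumes "finite V"
  shows "(\<lambda>U. a) \<in> lowdeg V d"
  using lowdeg_scale[OF lowdeg_monomial[OF assms, of "{}" d], of a] by simp

text \<open>Inclusion-exclusion, by expanding the product of the factors
  \<open>1 - of_bool (x \<in> U)\<close> over \<open>S\<close>.\<close>

lemma of_bool_disjoint_eq_alternating_sum:
  fixes S U :: "'v set"
  assumes "finite S"
  shows "(of_bool (S \<inter> U = {}) :: 'a::comm_ring_1) = (\<Sum>R\<in>Pow S. (-1) ^ card R * of_bool (R \<subseteq> U))"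
proof -
  have prod: "(\<Prod>x\<in>R. of_bool (P x)) = (of_bool (\<forall>x\<in>R. P x) :: 'a)" if "finite R" for R :: "'v set" and P
    using that by (induction R) auto
  have "(of_bool (S \<inter> U = {}) :: 'a) = (\<Prod>x\<in>S. of_bool (x \<notin> U))"
    using assms by (subst prod) (auto intro!: arg_cong[of _ _ of_bool])
  also have "\<dots> = (\<Prod>x\<in>S. 1 - of_bool (x \<in> U))"
    by (intro prod.cong) auto
  also have "\<dots> = (\<Sum>R\<in>Pow S. (-1) ^ card R * (\<Prod>x\<in>R. of_bool (x \<in> U)))"
    using assms by (simp add: prod_diff_conv_sum)
  also have "\<dots> = (\<Sum>R\<in>Pow S. (-1) ^ card R * of_bool (R \<subseteq> U))"
    using assms by (intro sum.cong refl) (simp add: prod finite_subset subset_eq)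
  finally show ?thesis .
qed

text \<open>\<open>S \<subseteq> V - U\<close> says that \<open>S\<close> and \<open>U\<close> are
  disjoint, and inclusion-exclusion expresses this by subsets of \<open>S\<close>, so the degree
  does not grow.\<close>

lemma lowdeg_complement:
  assumes "finite V" "g \<in> lowdeg V d"
  shows "(\<lambda>U. g (V - U)) \<in> lowdeg V d"
proof -
  obtain c where c: "\<And>U. g U = (\<Sum>S | S \<subseteq> V \<and> card S \<le> d. c S * of_bool (S \<subseteq> U))"
    using assms(2) by (rule lowdegE) (rule that)
  have eq: "g (V - U) = (\<Sum>S | S \<subseteq> V \<and> card S \<le> d. c S * (\<Sum>R\<in>Pow S. (-1) ^ card R * of_bool (R \<subseteq> U)))"
    for U
    unfolding c
  proof (intro sum.cong refl)
    fix S assume "S \<in> {S. S \<subseteq> V \<and> card S \<le> d}"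
    then have "finite S" "S \<subseteq> V - U \<longleftrightarrow> S \<inter> U = {}" using assms(1) finite_subset by auto
    then show "c S * of_bool (S \<subseteq> V - U) = c S * (\<Sum>R\<in>Pow S. (-1) ^ card R * of_bool (R \<subseteq> U))"
      by (simp only: of_bool_disjoint_eq_alternating_sum)
  qed
  have "card R \<le> d" if "S \<subseteq> V" "card S \<le> d" "R \<subseteq> S" for R S
    using that assms(1) by (meson card_mono finite_subset le_trans)
  then show ?thesis
    unfolding eq using assms(1) by (intro lowdeg_sum lowdeg_scale lowdeg_monomial) auto
qed

section \<open>Separation and interpolation of layers\<close>

lemma lowdeg_separates_below_degree:
  assumes "finite V" "T \<subseteq> V" "i < d" "card T \<noteq> i"
  obtains g :: "'v set \<Rightarrow> 'a::comm_ring_1" where "g \<in> lowdeg V d"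
    "\<And>U. U \<subseteq> V \<Longrightarrow> card U = i \<Longrightarrow> g U = 0" "g T = 1"
proof (cases "card T < i")
  case True
  \<comment> \<open>On layer \<open>i\<close> the only \<open>R\<close> inside \<open>U\<close> is
    \<open>U\<close> itself, so the two terms cancel; at \<open>T\<close> every \<open>R\<close> is
    too large to fit.\<close>
  let ?g = "\<lambda>U. of_bool (T \<subseteq> U) - (\<Sum>R | T \<subseteq> R \<and> R \<subseteq> V \<and> card R = i. of_bool (R \<subseteq> U)) :: 'a"
  have "?g \<in> lowdeg V d"
    using True assms by (intro lowdeg_diff lowdeg_monomial lowdeg_sum) auto
  moreover have "?g U = 0" if U: "U \<subseteq> V" "card U = i" for U
  proof -
    have "of_bool (R \<subseteq> U) = (if R = U then 1 else 0 :: 'a)" if "card R = i" for R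
      using that U assms(1) by (auto dest: card_subset_eq[rotated] finite_subset)
    then have "(\<Sum>R | T \<subseteq> R \<and> R \<subseteq> V \<and> card R = i. of_bool (R \<subseteq> U) :: 'a)
        = (\<Sum>R | T \<subseteq> R \<and> R \<subseteq> V \<and> card R = i. if R = U then 1 else 0)"
      by (intro sum.cong) auto
    also have "\<dots> = of_bool (T \<subseteq> U)" using assms(1) U by simp
    finally show ?thesis by simp
  qed
  moreover have "(\<Sum>R | T \<subseteq> R \<and> R \<subseteq> V \<and> card R = i. of_bool (R \<subseteq> T) :: 'a) = 0"
    using True by (intro sum.neutral) auto
  ultimately show ?thesis by (intro that[of ?g]) auto
next
  case False
  \<comment> \<open>The strict bound \<open>i < d\<close> leaves room for a monomial in
    \<open>i + 1\<close> variables, which no \<open>U\<close> of size \<open>i\<close> can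
    contain.\<close>
  then have "Suc i \<le> card T" using assms by simp
  then obtain R where R: "R \<subseteq> T" "card R = Suc i"
    by (metis obtain_subset_with_card_n)
  have "\<not> R \<subseteq> U" if "U \<subseteq> V" "card U = i" for U
    using that R assms(1) by (metis card_mono finite_subset not_less_eq_eq order_refl)
  with R assms show ?thesis
    by (intro that[of "\<lambda>U. of_bool (R \<subseteq> U)"] lowdeg_monomial) auto
qed

text \<open>Complementation moves layer \<open>i\<close> to layer \<open>card V - i\<close>, which
  lies below \<open>d\<close>.\<close>

lemma lowdeg_separates_above_codegree:
  assumes "finite V" "T \<subseteq> V" "card V < i + d" "i \<le> card V" "card T \<noteq> i"
  obtains g :: "'v set \<Rightarrow> 'a::comm_ring_1" where "g \<in> lowdeg V d"
    "\<And>U. U \<subseteq> V \<Longrightarrow> card U = i \<Longrightarrow> g U = 0" "g T = 1"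
proof -
  have card: "card (V - U) = card V - card U" "card U \<le> card V" if "U \<subseteq> V" for U
    using that assms(1) by (auto simp: card_Diff_subset finite_subset card_mono)
  obtain g :: "'v set \<Rightarrow> 'a" where g: "g \<in> lowdeg V d"
    "\<And>U. U \<subseteq> V \<Longrightarrow> card U = card V - i \<Longrightarrow> g U = 0" "g (V - T) = 1"
    using lowdeg_separates_below_degree[OF assms(1), of "V - T" "card V - i" d] assms card[OF assms(2)]
    by (metis Diff_subset add.commute diff_diff_cancel less_diff_conv2)
  show ?thesis
    using g(2,3) card by (intro that[OF lowdeg_complement[OF assms(1) g(1)]]) auto
qed

text \<open>The value of the elementary symmetric polynomial of degree \<open>k\<close> at the point
  with support \<open>U\<close>.\<close>

lemma sum_of_bool_subset_card:
  assumes "finite V" "U \<subseteq> V"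
  shows "(\<Sum>R | R \<subseteq> V \<and> card R = k. of_bool (R \<subseteq> U)) = (of_nat (card U choose k) :: 'a::comm_ring_1)"
proof -
  have "(\<Sum>R | R \<subseteq> V \<and> card R = k. of_bool (R \<subseteq> U) :: 'a) = of_nat (card {R. R \<subseteq> U \<and> card R = k})"
    using assms by simp (intro arg_cong[of _ _ "\<lambda>X. of_nat (card X)"], auto)
  with assms show ?thesis by (simp add: n_subsets finite_subset)
qed

text \<open>Incongruence modulo \<open>p ^ l\<close> shows in some binomial coefficient with
  \<open>p ^ k\<close> below, \<open>k < l\<close>. The separator is the elementary symmetric
  polynomial of degree \<open>p ^ k\<close> minus its constant value on layer
  \<open>i\<close>.\<close>

lemma lowdeg_separates_residues:
  assumes "finite V" "T \<subseteq> V" "prime p" "CHAR('a) = p"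
    and small: "\<And>k. k < l \<Longrightarrow> p ^ k \<le> d" and "\<not> [card T = i] (mod p ^ l)"
  obtains g :: "'v set \<Rightarrow> 'a::comm_ring_1" where "g \<in> lowdeg V d"
    "\<And>U. U \<subseteq> V \<Longrightarrow> card U = i \<Longrightarrow> g U = 0" "g T \<noteq> 0"
proof -
  obtain k where k: "k < l" "\<not> [card T choose (p ^ k) = i choose (p ^ k)] (mod p)"
    using assms cong_prime_power_if_binomials_cong by blast
  define g where
    "g U = (\<Sum>R | R \<subseteq> V \<and> card R = p ^ k. of_bool (R \<subseteq> U)) - (of_nat (i choose (p ^ k)) :: 'a)" for U
  have "g \<in> lowdeg V d"
    unfolding g_def using assms(1) small[OF k(1)]
    by (intro lowdeg_diff lowdeg_const lowdeg_sum lowdeg_monomial) auto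
  moreover have "g U = of_nat (card U choose (p ^ k)) - of_nat (i choose (p ^ k))" if "U \<subseteq> V" for U
    unfolding g_def using that assms(1) by (simp only: sum_of_bool_subset_card)
  ultimately show ?thesis
    using k(2) assms(2,4) by (intro that[of g]) (auto simp: of_nat_eq_iff_cong_CHAR)
qed

section \<open>Interpolation between congruent layers\<close>

text \<open>Such an \<open>R\<close> is \<open>S\<close> together with an arbitrary subset of
  \<open>B - S\<close> of size \<open>d - card S\<close>.\<close>

lemma card_subsets_between:
  assumes "finite B" "S \<subseteq> B" "card S \<le> d"
  shows "card {R. S \<subseteq> R \<and> R \<subseteq> B \<and> card R = d} = (card B - card S) choose (d - card S)"
proof -
  have fin: "finite S" "finite (B - S)" using assms finite_subset by auto
  have "bij_betw (\<lambda>R. S \<union> R) {R. R \<subseteq> B - S \<and> card R = d - card S} {R. S \<subseteq> R \<and> R \<subseteq> B \<and> card R = d}"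
  proof (rule bij_betw_byWitness[where f' = "\<lambda>R. R - S"])
    show "(\<union>) S ` {R. R \<subseteq> B - S \<and> card R = d - card S} \<subseteq> {R. S \<subseteq> R \<and> R \<subseteq> B \<and> card R = d}"
    proof clarify
      fix R assume R: "R \<subseteq> B - S" "card R = d - card S"
      then have "card (S \<union> R) = card S + card R"
        using fin by (intro card_Un_disjoint) (auto dest: finite_subset)
      with R assms show "S \<subseteq> S \<union> R \<and> S \<union> R \<subseteq> B \<and> card (S \<union> R) = d" by auto
    qed
    show "(\<lambda>R. R - S) ` {R. S \<subseteq> R \<and> R \<subseteq> B \<and> card R = d} \<subseteq> {R. R \<subseteq> B - S \<and> card R = d - card S}"
      using fin by (auto simp: card_Diff_subset)
  qed auto
  then have "card {R. S \<subseteq> R \<and> R \<subseteq> B \<and> card R = d} = card {R. R \<subseteq> B - S \<and> card R = d - card S}"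
    by (rule bij_betw_same_card[symmetric])
  also have "\<dots> = card (B - S) choose (d - card S)" using fin by (simp add: n_subsets)
  finally show ?thesis using fin assms by (simp add: card_Diff_subset)
qed

text \<open>The value at \<open>T\<close> is a sum of values on layer \<open>i\<close>: split \<open>T\<close> into \<open>A\<close> and \<open>B\<close> with
  \<open>card B = d + (card T - i)\<close> and sum over all \<open>A \<union> R\<close> with \<open>R\<close> a \<open>d\<close>-subset of \<open>B\<close>. A monomial
  meeting \<open>B\<close> in \<open>s\<close> points is counted \<open>(d - s + (card T - i)) choose (d - s)\<close> times, which
  is \<open>1\<close> modulo \<open>p\<close>.\<close>

lemma lowdeg_vanishes_above_layer:
  fixes g :: "'v set \<Rightarrow> 'a::comm_ring_1"
  assumes "finite V" "T \<subseteq> V" "prime p" "CHAR('a) = p" "d < p ^ l"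
    and "d \<le> i" "i \<le> card T" "[card T = i] (mod p ^ l)"
    and g: "g \<in> lowdeg V d" "\<And>U. U \<subseteq> V \<Longrightarrow> card U = i \<Longrightarrow> g U = 0"
  shows "g T = 0"
proof -
  obtain q where q: "card T = i + q * p ^ l"
    using assms(7,8) by (metis add.commute cong_le_nat)
  have finT: "finite T" using assms finite_subset by blast
  have "d + q * p ^ l \<le> card T" using q assms by simp
  then obtain B where B: "B \<subseteq> T" "card B = d + q * p ^ l"
    by (metis obtain_subset_with_card_n)
  define A where "A = T - B"
  have finB: "finite B" using B finT finite_subset by blast
  \<comment> \<open>The size of \<open>B\<close> is chosen so that adding a \<open>d\<close>-subset
    of \<open>B\<close> to \<open>A\<close> lands exactly in layer \<open>i\<close>.\<close>
  have A: "card A = i - d" "A \<inter> B = {}" "A \<union> B = T" "finite A"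
    unfolding A_def using B q finB finT by (auto simp: card_Diff_subset)
  let ?D = "{R. R \<subseteq> B \<and> card R = d}"
  obtain c where c: "\<And>U. g U = (\<Sum>S | S \<subseteq> V \<and> card S \<le> d. c S * of_bool (S \<subseteq> U))"
    using g(1) by (rule lowdegE) (rule that)
  have count: "(\<Sum>R\<in>?D. of_bool (S \<subseteq> A \<union> R)) = (of_bool (S \<subseteq> T) :: 'a)"
    if S: "S \<subseteq> V" "card S \<le> d" for S
  proof (cases "S \<subseteq> T")
    case True
    let ?s = "card (S \<inter> B)"
    have s: "?s \<le> d" using S assms(1) by (meson Int_lower1 card_mono finite_subset le_trans)
    have sets: "?D \<inter> {R. S \<subseteq> A \<union> R} = {R. S \<inter> B \<subseteq> R \<and> R \<subseteq> B \<and> card R = d}"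
      using True A by blast
    have "(\<Sum>R\<in>?D. of_bool (S \<subseteq> A \<union> R) :: 'a) = of_nat (card {R. S \<inter> B \<subseteq> R \<and> R \<subseteq> B \<and> card R = d})"
      using finB by (simp flip: sets)
    also have "\<dots> = of_nat ((card B - ?s) choose (d - ?s))"
      using finB s by (subst card_subsets_between) auto
    also have "card B - ?s = (d - ?s) + q * p ^ l" using B s by simp
    also have "of_nat (((d - ?s) + q * p ^ l) choose (d - ?s)) = (of_nat ((d - ?s) choose (d - ?s)) :: 'a)"
      using binomial_add_multiple_prime_power_cong[of p "d - ?s" l "d - ?s" q] assms(3,4,5)
      by (simp only: of_nat_eq_iff_cong_CHAR)
    finally show ?thesis using True by simp
  next
    case False
    then have "\<not> S \<subseteq> A \<union> R" if "R \<subseteq> B" for R using that A by blast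
    with False show ?thesis by (auto intro!: sum.neutral)
  qed
  have zero: "g (A \<union> R) = 0" if "R \<in> ?D" for R
  proof (rule g(2))
    show "A \<union> R \<subseteq> V" using that A assms(2) by blast
    have "card (A \<union> R) = card A + card R"
      using that A finB by (intro card_Un_disjoint) (auto dest: finite_subset)
    then show "card (A \<union> R) = i" using that A assms by simp
  qed
  have "g T = (\<Sum>S | S \<subseteq> V \<and> card S \<le> d. c S * (\<Sum>R\<in>?D. of_bool (S \<subseteq> A \<union> R)))"
    unfolding c by (intro sum.cong refl) (auto simp: count)
  \<comment> \<open>Exchanging the two sums turns the weighted count of monomials into values of
    \<open>g\<close> on layer \<open>i\<close>.\<close>
  also have "\<dots> = (\<Sum>R\<in>?D. g (A \<union> R))"
    unfolding c sum_distrib_left by (rule sum.swap)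
  also have "\<dots> = 0" using zero by (intro sum.neutral) blast
  finally show ?thesis .
qed

text \<open>Complementation preserves the congruence and turns \<open>i + d \<le> card V\<close>
  into \<open>d \<le> card V - i\<close>, so the case above the layer applies.\<close>

lemma lowdeg_vanishes_below_layer:
  fixes g :: "'v set \<Rightarrow> 'a::comm_ring_1"
  assumes "finite V" "T \<subseteq> V" "prime p" "CHAR('a) = p" "d < p ^ l"
    and "i + d \<le> card V" "card T \<le> i" "[card T = i] (mod p ^ l)"
    and g: "g \<in> lowdeg V d" "\<And>U. U \<subseteq> V \<Longrightarrow> card U = i \<Longrightarrow> g U = 0"
  shows "g T = 0"
proof -
  have card: "card (V - U) = card V - card U" if "U \<subseteq> V" for U
    using that assms(1) by (auto simp: card_Diff_subset finite_subset)
  have "[card V - card T = card V - i] (mod p ^ l)"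
    using assms(6,7,8) by (metis add_leD1 cong_diff_nat cong_refl le_trans)
  then have "g (V - (V - T)) = 0"
    using assms card
    by (intro lowdeg_vanishes_above_layer[OF assms(1) _ assms(3-5) _ _ _
          lowdeg_complement[OF assms(1) g(1)], of "V - T" "card V - i"]) auto
  moreover have "V - (V - T) = T" using assms(2) by blast
  ultimately show ?thesis by simp
qed

section \<open>Polynomials on the cube\<close>

definition cube_support :: "nat \<Rightarrow> (nat \<Rightarrow> 'a::zero_neq_one) \<Rightarrow> nat set" where
  "cube_support n x = {j \<in> {1..n}. x j = 1}"

text \<open>Inverse to \<open>cube_support\<close> on subsets of \<open>{1..n}\<close>;
  \<open>restrict\<close> is needed because points of \<open>cube n\<close> are extensional
  functions.\<close>

definition cube_point :: "nat \<Rightarrow> nat set \<Rightarrow> nat \<Rightarrow> 'a::zero_neq_one" where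
  "cube_point n U = restrict (\<lambda>j. of_bool (j \<in> U)) {1..n}"

lemma cube_support_subset: "cube_support n x \<subseteq> {1..n}"
  by (auto simp: cube_support_def)

lemma hamming_weight_eq_card_support: "hamming_weight n x = card (cube_support n x)"
  by (simp add: hamming_weight_def cube_support_def)

lemma cube_point_in_cube: "cube_point n U \<in> cube n"
  by (auto simp: cube_point_def cube_def)

lemma cube_support_point: "U \<subseteq> {1..n} \<Longrightarrow> cube_support n (cube_point n U) = U"
  by (auto simp: cube_point_def cube_support_def)

text \<open>Exponents of occurring variables are positive, and positive powers of 0 and 1 do not
  depend on the exponent, so only the set of variables of each monomial matters.\<close>

lemma eval_mpoly_on_cube:
  fixes x :: "nat \<Rightarrow> 'a::comm_ring_1"
  assumes "x \<in> cube n" "f \<in> polys_in n"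
  shows "eval_mpoly f x = (\<Sum>m\<in>Poly_Mapping.keys f.
    Poly_Mapping.lookup f m * of_bool (Poly_Mapping.keys m \<subseteq> cube_support n x))"
  unfolding eval_mpoly_def
proof (intro sum.cong refl)
  fix m assume m: "m \<in> Poly_Mapping.keys f"
  then have sub: "Poly_Mapping.keys m \<subseteq> {1..n}" using assms(2) by (auto simp: polys_in_def)
  have x: "x j = of_bool (j \<in> cube_support n x)" if "j \<in> {1..n}" for j
    using that assms(1) by (auto simp: cube_def cube_support_def PiE_iff)
  have "(\<Prod>j\<in>Poly_Mapping.keys m. x j ^ Poly_Mapping.lookup m j)
      = of_bool (Poly_Mapping.keys m \<subseteq> cube_support n x)"
  proof (cases "Poly_Mapping.keys m \<subseteq> cube_support n x")
    case True
    then have "x j ^ Poly_Mapping.lookup m j = 1" if "j \<in> Poly_Mapping.keys m" for j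
      using that sub x[of j] by (simp add: subset_iff del: atLeastAtMost_iff)
    with True show ?thesis by simp
  next
    case False
    then obtain j where j: "j \<in> Poly_Mapping.keys m" "j \<notin> cube_support n x" by blast
    then have "x j ^ Poly_Mapping.lookup m j = 0"
      using sub x[of j] by (simp add: subset_iff in_keys_iff zero_power del: atLeastAtMost_iff)
    with j False show ?thesis by (auto intro!: prod_zero)
  qed
  then show "Poly_Mapping.lookup f m * (\<Prod>j\<in>Poly_Mapping.keys m. x j ^ Poly_Mapping.lookup m j) =
    Poly_Mapping.lookup f m * of_bool (Poly_Mapping.keys m \<subseteq> cube_support n x)" by simp
qed

lemma card_keys_le_monomial_degree: "card (Poly_Mapping.keys m) \<le> monomial_degree m"
proof -
  have "card (Poly_Mapping.keys m) = (\<Sum>j\<in>Poly_Mapping.keys m. 1)" by simp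
  also have "\<dots> \<le> monomial_degree m"
    unfolding monomial_degree_def by (intro sum_mono) (simp add: in_keys_iff Suc_le_eq)
  finally show ?thesis .
qed

lemma total_degree_le_iff: "total_degree f \<le> d \<longleftrightarrow> (\<forall>m\<in>Poly_Mapping.keys f. monomial_degree m \<le> d)"
  by (simp add: total_degree_def)

text \<open>Replacing each monomial by its set of variables keeps the values on the cube, and the
  number of variables never exceeds the degree.\<close>

lemma lowdeg_of_mpoly:
  fixes f :: "'a::comm_ring_1 mpoly"
  assumes "f \<in> polys_in n" "total_degree f \<le> d"
  obtains g where "g \<in> lowdeg {1..n} d" "\<And>x. x \<in> cube n \<Longrightarrow> eval_mpoly f x = g (cube_support n x)"
proof
  let ?g = "\<lambda>U. \<Sum>m\<in>Poly_Mapping.keys f. Poly_Mapping.lookup f m * of_bool (Poly_Mapping.keys m \<subseteq> U)"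
  have "card (Poly_Mapping.keys m) \<le> d" if "m \<in> Poly_Mapping.keys f" for m
    using that assms(2) card_keys_le_monomial_degree le_trans by (fastforce simp: total_degree_le_iff)
  then show "?g \<in> lowdeg {1..n} d"
    using assms(1)
    by (intro lowdeg_sum lowdeg_scale lowdeg_monomial) (auto simp: polys_in_def)
  show "eval_mpoly f x = ?g (cube_support n x)" if "x \<in> cube n" for x
    using that assms(1) by (rule eval_mpoly_on_cube)
qed

text \<open>Meaningful for finite \<open>S\<close> only, since \<open>Abs_poly_mapping\<close>
  expects finite support.\<close>

definition multilinear_monomial :: "nat set \<Rightarrow> monomial" where
  "multilinear_monomial S = Abs_poly_mapping (\<lambda>j. of_bool (j \<in> S))"

lemma lookup_multilinear_monomial:
  "finite S \<Longrightarrow> Poly_Mapping.lookup (multilinear_monomial S) = (\<lambda>j. of_bool (j \<in> S))"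
  unfolding multilinear_monomial_def by (rule lookup_Abs_poly_mapping) simp

lemma keys_multilinear_monomial: "finite S \<Longrightarrow> Poly_Mapping.keys (multilinear_monomial S) = S"
  by (auto simp: in_keys_iff lookup_multilinear_monomial)

lemma monomial_degree_multilinear_monomial: "finite S \<Longrightarrow> monomial_degree (multilinear_monomial S) = card S"
  by (simp add: monomial_degree_def keys_multilinear_monomial lookup_multilinear_monomial)

lemma mpoly_of_lowdeg:
  fixes g :: "nat set \<Rightarrow> 'a::comm_ring_1"
  assumes "g \<in> lowdeg {1..n} d"
  obtains f where "f \<in> polys_in n" "total_degree f \<le> d"
    "\<And>x. x \<in> cube n \<Longrightarrow> eval_mpoly f x = g (cube_support n x)"
proof -
  let ?D = "{S. S \<subseteq> {1..n} \<and> card S \<le> d}"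
  obtain c where c: "\<And>U. g U = (\<Sum>S\<in>?D. c S * of_bool (S \<subseteq> U))"
    using assms by (rule lowdegE) (rule that)
  let ?M = "multilinear_monomial ` ?D"
  \<comment> \<open>Taking \<open>keys\<close> recovers \<open>S\<close> from its monomial, so each
    coefficient \<open>c S\<close> is placed at the monomial of \<open>S\<close>.\<close>
  define f where "f = Abs_poly_mapping (\<lambda>m. if m \<in> ?M then c (Poly_Mapping.keys m) else 0)"
  have finM: "finite ?M" by simp
  have fin: "finite S" if "S \<in> ?D" for S using that finite_subset by auto
  have lookup: "Poly_Mapping.lookup f = (\<lambda>m. if m \<in> ?M then c (Poly_Mapping.keys m) else 0)"
    unfolding f_def using finM by (intro lookup_Abs_poly_mapping) (auto elim: rev_finite_subset)
  have keys: "Poly_Mapping.keys f \<subseteq> ?M"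
    by (auto simp: in_keys_iff lookup split: if_splits)
  have inj: "inj_on multilinear_monomial ?D"
    by (rule inj_onI) (metis fin keys_multilinear_monomial)
  have support: "Poly_Mapping.keys m \<subseteq> {1..n} \<and> monomial_degree m \<le> d" if "m \<in> Poly_Mapping.keys f" for m
  proof -
    from that keys obtain S where "S \<in> ?D" "m = multilinear_monomial S" by blast
    then show ?thesis
      using fin[of S] by (simp add: keys_multilinear_monomial monomial_degree_multilinear_monomial)
  qed
  have f: "f \<in> polys_in n" using support by (simp add: polys_in_def)
  moreover have "total_degree f \<le> d" using support by (simp add: total_degree_le_iff)
  moreover have "eval_mpoly f x = g (cube_support n x)" if "x \<in> cube n" for x
  proof -
    \<comment> \<open>Some \<open>c S\<close> may be 0, so the keys of \<open>f\<close> can be fewer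
      than \<open>?M\<close>; the added terms vanish.\<close>
    have "eval_mpoly f x = (\<Sum>m\<in>?M. Poly_Mapping.lookup f m * of_bool (Poly_Mapping.keys m \<subseteq> cube_support n x))"
      unfolding eval_mpoly_on_cube[OF that f]
      using finM keys by (intro sum.mono_neutral_left) (auto simp: in_keys_iff)
    also have "\<dots> = (\<Sum>S\<in>?D. Poly_Mapping.lookup f (multilinear_monomial S)
        * of_bool (Poly_Mapping.keys (multilinear_monomial S) \<subseteq> cube_support n x))"
      by (rule sum.reindex_cong[OF inj refl refl])
    also have "\<dots> = (\<Sum>S\<in>?D. c S * of_bool (S \<subseteq> cube_support n x))"
    proof (rule sum.cong[OF refl])
      fix S assume S: "S \<in> ?D"
      then have "Poly_Mapping.lookup f (multilinear_monomial S) = c S"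
        by (simp only: lookup imageI if_True keys_multilinear_monomial[OF fin])
      then show "Poly_Mapping.lookup f (multilinear_monomial S)
          * of_bool (Poly_Mapping.keys (multilinear_monomial S) \<subseteq> cube_support n x)
          = c S * of_bool (S \<subseteq> cube_support n x)"
        by (simp only: keys_multilinear_monomial[OF fin[OF S]])
    qed
    also have "\<dots> = g (cube_support n x)" by (rule c[symmetric])
    finally show ?thesis .
  qed
  ultimately show ?thesis using that by blast
qed

section \<open>Closure membership in terms of low-degree functions\<close>

lemma not_in_Zcl_if_separated:
  fixes g :: "nat set \<Rightarrow> 'a::field" and y :: "nat \<Rightarrow> 'a"
  assumes "g \<in> lowdeg {1..n} d" "\<And>U. U \<subseteq> {1..n} \<Longrightarrow> card U \<in> E \<Longrightarrow> g U = 0"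
    and "g (cube_support n y) \<noteq> 0"
  shows "y \<notin> Zcl n d (weight_layers n E)"
proof
  assume y: "y \<in> Zcl n d (weight_layers n E)"
  obtain f where f: "f \<in> polys_in n" "total_degree f \<le> d"
    "\<And>x. x \<in> cube n \<Longrightarrow> eval_mpoly f x = g (cube_support n x)"
    using assms(1) by (rule mpoly_of_lowdeg) blast
  have "eval_mpoly f x = 0" if "x \<in> weight_layers n E" for x
    using that assms(2)[OF cube_support_subset] f(3)
    by (auto simp: weight_layers_def hamming_weight_eq_card_support)
  then have "eval_mpoly f y = 0" "y \<in> cube n" using y f(1,2) by (auto simp: Zcl_def)
  with f(3) assms(3) show False by simp
qed

text \<open>Every admissible polynomial acts on the cube as a low-degree function, and every
  \<open>U\<close> in the layers is the support of a cube point, so vanishing carries over.\<close>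

lemma cube_point_in_Zcl:
  assumes "T \<subseteq> {1..n}"
    and "\<And>g. g \<in> lowdeg {1..n} d \<Longrightarrow> (\<And>U. U \<subseteq> {1..n} \<Longrightarrow> card U \<in> E \<Longrightarrow> g U = 0) \<Longrightarrow> g T = (0 :: 'a::field)"
  shows "(cube_point n T :: nat \<Rightarrow> 'a) \<in> Zcl n d (weight_layers n E)"
  unfolding Zcl_def
proof (intro CollectI conjI ballI impI)
  fix f :: "'a mpoly"
  assume f: "f \<in> polys_in n" "total_degree f \<le> d" "\<forall>x\<in>weight_layers n E. eval_mpoly f x = 0"
  obtain g where g: "g \<in> lowdeg {1..n} d" "\<And>x. x \<in> cube n \<Longrightarrow> eval_mpoly f x = g (cube_support n x)"
    using lowdeg_of_mpoly[OF f(1,2)] by blast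
  have "g U = 0" if "U \<subseteq> {1..n}" "card U \<in> E" for U
    using that f(3) g(2)[OF cube_point_in_cube, of U]
    by (auto simp: weight_layers_def hamming_weight_eq_card_support cube_support_point cube_point_in_cube)
  then show "eval_mpoly f (cube_point n T) = 0"
    using assms g by (simp add: cube_point_in_cube cube_support_point)
qed (rule cube_point_in_cube)

section \<open>Digit length and the final case analysis\<close>

text \<open>With \<open>power_le_if_less_digit_length\<close>, this makes
  \<open>digit_length p d\<close> the least \<open>l\<close> with \<open>d < p ^ l\<close>.\<close>

lemma less_power_digit_length:
  assumes "p > 1"
  shows "d < p ^ digit_length p d"
proof -
  have "log p (d + 1) \<le> digit_length p d" unfolding digit_length_def by linarith
  then have "real (d + 1) \<le> p powr digit_length p d"
    using assms by (simp add: log_le_iff)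
  also have "\<dots> = real (p ^ digit_length p d)" using assms by (simp add: powr_realpow)
  finally show ?thesis by linarith
qed

lemma power_le_if_less_digit_length:
  assumes "p > 1" "k < digit_length p d"
  shows "p ^ k \<le> d"
proof -
  have "k < log p (d + 1)" using assms(2) unfolding digit_length_def by linarith
  then have "p powr k < real (d + 1)"
    using assms(1) by (simp add: less_log_iff)
  then have "real (p ^ k) < real (d + 1)" using assms(1) by (simp add: powr_realpow)
  then show ?thesis by linarith
qed

theorem theorem1p5:
  fixes p n i d l :: nat
  assumes "prime p" and "CARD('p::prime_card) = p"
    and "n > 0" and "i \<in> {0..n}" and "d \<in> {0..n}"
    and "l = digit_length p d"
  shows "Zcl_weights TYPE('p mod_ring) n d {i} =
    (if i \<in> {d..n - d} then residue_layers n i (p ^ l) else {i})"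
proof -
  let ?V = "{1..n}"
  let ?W = "if i \<in> {d..n - d} then residue_layers n i (p ^ l) else {i}"
  let ?Z = "Zcl n d (weight_layers n {i}) :: (nat \<Rightarrow> 'p mod_ring) set"
  have p: "p > 1" using assms(1) by (rule prime_gt_1_nat)
  have char: "CHAR('p mod_ring) = p" using assms(2) by simp
  have low: "d < p ^ l" and small: "\<And>k. k < l \<Longrightarrow> p ^ k \<le> d"
    using less_power_digit_length[OF p] power_le_if_less_digit_length[OF p] assms(6) by auto
  have "hamming_weight n y \<in> ?W" if "y \<in> ?Z" for y
  proof (rule ccontr)
    assume neg: "hamming_weight n y \<notin> ?W"
    let ?T = "cube_support n y"
    have T: "?T \<subseteq> ?V" "hamming_weight n y = card ?T"
      by (rule cube_support_subset hamming_weight_eq_card_support)+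
    have "card ?T \<le> n" using T(1) card_mono[of ?V ?T] by simp
    \<comment> \<open>The first two cases are those of \<open>i\<close> outside
      \<open>[d, n - d]\<close>; inside, a weight of at most \<open>n\<close> can only fail the
      congruence.\<close>
    then consider "i < d" "card ?T \<noteq> i" | "n < i + d" "card ?T \<noteq> i" | "\<not> [card ?T = i] (mod p ^ l)"
      using neg T(2) by (auto simp: residue_layers_def split: if_splits)
    then obtain g :: "nat set \<Rightarrow> 'p mod_ring" where "g \<in> lowdeg ?V d"
      "\<And>U. U \<subseteq> ?V \<Longrightarrow> card U = i \<Longrightarrow> g U = 0" "g ?T \<noteq> 0"
    proof cases
      case 1
      show ?thesis
        by (rule lowdeg_separates_below_degree[OF _ T(1) 1, where ?'a = "'p mod_ring"]) (auto intro: that)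
    next
      case 2
      show ?thesis
        by (rule lowdeg_separates_above_codegree[OF _ T(1) _ _ 2(2), of d, where ?'a = "'p mod_ring"])
          (use 2 assms(4) in \<open>auto intro: that\<close>)
    next
      case 3
      show ?thesis
        by (rule lowdeg_separates_residues[OF _ T(1) assms(1) char small 3]) (auto intro: that)
    qed
    then show False using not_in_Zcl_if_separated[of g n d "{i}" y] that by auto
  qed
  moreover have "t \<in> hamming_weight n ` ?Z" if t: "t \<in> ?W" for t
  proof -
    have tn: "t \<le> n" using t assms(4) by (auto simp: residue_layers_def split: if_splits)
    \<comment> \<open>One point of weight \<open>t\<close> in the closure suffices; the one with
      support \<open>{1..t}\<close> is taken.\<close>
    have T: "{1..t} \<subseteq> ?V" "card {1..t} = t" using tn by auto
    have "(cube_point n {1..t} :: nat \<Rightarrow> 'p mod_ring) \<in> ?Z"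
    proof (rule cube_point_in_Zcl[OF T(1)])
      fix g :: "nat set \<Rightarrow> 'p mod_ring"
      assume g: "g \<in> lowdeg ?V d" "\<And>U. U \<subseteq> ?V \<Longrightarrow> card U \<in> {i} \<Longrightarrow> g U = 0"
      show "g {1..t} = 0"
      proof (cases "t = i")
        case True
        then show ?thesis using g(2) T by simp
      next
        case False
        \<comment> \<open>As \<open>t \<noteq> i\<close>, the set \<open>?W\<close> cannot be
          \<open>{i}\<close>, so \<open>i\<close> lies in \<open>[d, n - d]\<close>.\<close>
        then have i: "d \<le> i" "i + d \<le> n" "[t = i] (mod p ^ l)"
          using t assms(5) by (auto simp: residue_layers_def split: if_splits)
        show ?thesis
        proof (cases "i \<le> t")
          case True
          show ?thesis
            by (rule lowdeg_vanishes_above_layer[OF _ T(1) assms(1) char low i(1) _ _ g(1)])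
              (use True T i g in auto)
        next
          case False
          show ?thesis
            by (rule lowdeg_vanishes_below_layer[OF _ T(1) assms(1) char low _ _ _ g(1), of i])
              (use False T i g in auto)
        qed
      qed
    qed
    moreover have "hamming_weight n (cube_point n {1..t} :: nat \<Rightarrow> 'p mod_ring) = t"
      using T by (simp add: hamming_weight_eq_card_support cube_support_point)
    ultimately show ?thesis by (metis image_eqI)
  qed
  ultimately show ?thesis unfolding Zcl_weights_def by blast
qed

end
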